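(* Let $x,y\in\mathbb{YF}$ with $|y|\ge |x|$, and let $z=h(x,y)$. Then the number $d(x,y)$ of downward paths from $y$ to $x$ in the Young--Fibonacci graph is $$d(x,y)=\sum_{i=0}^{|x|}\left(f(x,i,z)\prod_{j=1}^{d(y)}\bigl(g(y,j)-i\bigr)\right).$$
   Context: $\mathbb{YF}$ is the set of all finite words over the alphabet $\{1,2\}$, including the empty word $\varepsilon$; words are concatenated by juxtaposition. For $x\in\mathbb{YF}$: $|x|$ is the sum of its digits, $\#x$ its number of digits, $d(x)$ its number of digits equal to $2$. Empty products equal $1$. Young--Fibonacci graph: vertex set $\mathbb{YF}$, graded by $|\cdot|$; the upward edges from $x$ go to the words obtained from $x$ by either (a) replacing the leftmost $1$ by $2$ (if $x$ contains a $1$), or (b) inserting a $1$ at a position to the left of the leftmost $1$ (if $x$ has no $1$, at any position, including both ends). So each edge joins a word of digit sum $n$ to one of digit sum $n+1$. For $|y|\ge|x|$, a downward path from $y$ to $x$ is a sequence $y=y_0,y_1,\dots,y_n=x$ of vertices, consecutive ones adjacent, with $|y_i|=|y|-i$ for all $i$ (so $n=|y|-|x|$); $d(x,y)$ is the number of such paths. $h(x,y)$ is the number of digits of the longest common suffix of $x$ and $y$. Function $f(x,y,z)$, for $x\in\mathbb{YF}$ and integers $0\le y\le |x|$, $0\le z\le \#x$: For $z=0$: if $x=\alpha_1\dots\alpha_n$ (digits $\alpha_i\in\{1,2\}$) and there is $m\in\{0,\dots,n\}$ with $\alpha_{m+1}+\dots+\alpha_n=y$, then $$f(x,y,0)=\frac{1}{(-\alpha_{m+1})(-\alpha_{m+1}-\alpha_{m+2})\cdots(-\alpha_{m+1}-\dots-\alpha_n)}\cdot\frac{1}{\alpha_m(\alpha_m+\alpha_{m-1})\cdots(\alpha_m+\dots+\alpha_1)};$$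 if there is no such $m$, then $f(x,y,0)=0$. For $z>0$, recursively: $f(x1,0,z)=f(x1,0,0)$; $f(x1,y,z)=f(x1,y,0)+f(x,y-1,z-1)$ if $y>0$; $f(x2,y,z)=\dfrac{f(x11,y,z+1)}{1-y}$ if $y\ne1$, and $f(x2,1,z)=0$. Function $g$: write $y=1^{\beta_{d(y)}}\,2\,1^{\beta_{d(y)-1}}\,2\cdots 2\,1^{\beta_1}\,2\,1^{\beta_0}$ with all $\beta_i\ge0$ ($1^{\beta}$ means $\beta$ ones). For $1\le m\le d(y)$, $g(y,m)=\beta_0+\dots+\beta_{m-1}+2m-1$. *)

theory Defs
  imports Complex_Main "HOL-Library.Sublist"
begin

section \<open>Words over the alphabet \<open>{1,2}\<close>\<close>

text \<open>Words are written left to right: the head of the list is the leftmost digit.\<close>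

datatype digit = One | Two

type_synonym word = "digit list"

primrec digit_val :: "digit \<Rightarrow> nat" where
  "digit_val One = 1"
| "digit_val Two = 2"

definition weight :: "word \<Rightarrow> nat" where
  "weight x = sum_list (map digit_val x)"

definition num_twos :: "word \<Rightarrow> nat" where
  "num_twos x = count_list x Two"

definition common_suffix_len :: "word \<Rightarrow> word \<Rightarrow> nat" where
  "common_suffix_len x y = Max {length w |w. suffix w x \<and> suffix w y}"

lemma weight_simps [simp]:
  "weight [] = 0"
  "weight (a # x) = digit_val a + weight x"
  "weight (x @ y) = weight x + weight y"
  by (simp_all add: weight_def)

lemma num_twos_simps [simp]:
  "num_twos [] = 0"
  "num_twos (One # x) = num_twos x"
  "num_twos (Two # x) = Suc (num_twos x)"
  "num_twos (x @ y) = num_twos x + num_twos y"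
  by (simp_all add: num_twos_def)

lemma digit_val_pos [simp]: "0 < digit_val a"
  by (cases a) simp_all

lemma length_le_weight: "length x \<le> weight x"
proof (induction x)
  case (Cons a x)
  then show ?case by (cases a) simp_all
qed simp

lemma finite_weight_le: "finite {x. weight x \<le> n}"
proof (rule finite_subset)
  have "c \<in> {One, Two}" for c
    by (cases c) simp_all
  then have "set x \<subseteq> {One, Two}" for x
    by blast
  then show "{x. weight x \<le> n} \<subseteq> {x. set x \<subseteq> {One, Two} \<and> length x \<le> n}"
    using length_le_weight order_trans by blast
  show "finite {x. set x \<subseteq> {One, Two} \<and> length x \<le> n}"
    by (rule finite_lists_length_le) simp
qed

section \<open>The Young--Fibonacci graph\<close>

text \<open>In both rules the prefix \<open>2\<dots>2\<close> lies to the left of every \<open>1\<close> of the lower word.\<close>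

inductive yf_up :: "word \<Rightarrow> word \<Rightarrow> bool" where
  replace: "yf_up (replicate k Two @ One # v) (replicate k Two @ Two # v)"
| insert: "yf_up (replicate k Two @ v) (replicate k Two @ One # v)"

definition yf_adjacent :: "word \<Rightarrow> word \<Rightarrow> bool" where
  "yf_adjacent u v \<longleftrightarrow> yf_up u v \<or> yf_up v u"

lemma weight_yf_up: "yf_up u v \<Longrightarrow> weight v = Suc (weight u)"
  by (induction rule: yf_up.induct) simp_all

definition downward_path :: "word \<Rightarrow> word \<Rightarrow> word list \<Rightarrow> bool" where
  "downward_path y x p \<longleftrightarrow>
     length p = Suc (weight y - weight x) \<and>
     p ! 0 = y \<and> p ! (weight y - weight x) = x \<and>
     (\<forall>i < weight y - weight x. yf_adjacent (p ! i) (p ! Suc i)) \<and>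
     (\<forall>i \<le> weight y - weight x. weight (p ! i) = weight y - i)"

definition num_paths :: "word \<Rightarrow> word \<Rightarrow> nat" where
  "num_paths x y = card {p. downward_path y x p}"

lemma finite_downward_paths: "finite {p. downward_path y x p}"
proof (rule finite_subset)
  show "{p. downward_path y x p} \<subseteq>
    {p. set p \<subseteq> {w. weight w \<le> weight y} \<and> length p = Suc (weight y - weight x)}"
  proof (intro subsetI CollectI conjI)
    fix p w
    assume p: "p \<in> {p. downward_path y x p}"
    then show "length p = Suc (weight y - weight x)"
      by (simp add: downward_path_def)
    assume "w \<in> set p"
    then obtain i where "i < length p" "w = p ! i"
      by (metis in_set_conv_nth)
    with p show "weight w \<le> weight y"
      by (simp add: downward_path_def)
  qed
  show "finite {p. set p \<subseteq> {w. weight w \<le> weight y} \<and> length p = Suc (weight y - weight x)}"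
    by (rule finite_lists_length_eq) (rule finite_weight_le)
qed

section \<open>The function \<open>f\<close>\<close>

text \<open>\<open>alpha x i\<close> is the \<open>i\<close>-th digit from the left, counted from 1.\<close>

definition alpha :: "word \<Rightarrow> nat \<Rightarrow> real" where
  "alpha x i = real (digit_val (x ! (i - 1)))"

definition is_split :: "word \<Rightarrow> nat \<Rightarrow> nat \<Rightarrow> bool" where
  "is_split x y m \<longleftrightarrow> m \<le> length x \<and> weight (drop m x) = y"

lemma is_split_unique:
  assumes "is_split x y m" and "is_split x y m'"
  shows "m = m'"
proof -
  have "\<not> is_split x y l" if "is_split x y k" "k < l" for k l
  proof
    assume l: "is_split x y l"
    have "drop k x = take (l - k) (drop k x) @ drop l x"
      using append_take_drop_id[of "l - k" "drop k x"] that by simp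
    then have "weight (drop k x) = weight (take (l - k) (drop k x)) + weight (drop l x)"
      using weight_simps(3)[of "take (l - k) (drop k x)" "drop l x"] by argo
    moreover have "0 < length (take (l - k) (drop k x))"
      using that l by (auto simp: is_split_def)
    ultimately show False
      using that l length_le_weight[of "take (l - k) (drop k x)"]
      unfolding is_split_def by linarith
  qed
  then show ?thesis
    using assms by (meson linorder_neqE_nat)
qed

definition f0 :: "word \<Rightarrow> nat \<Rightarrow> real" where
  "f0 x y =
     (if \<exists>m. is_split x y m then
        let m = (THE m. is_split x y m); n = length x in
          1 / (\<Prod>k = m+1..n. - (\<Sum>i = m+1..k. alpha x i)) *
          (1 / (\<Prod>k = 1..m. \<Sum>i = k..m. alpha x i))
      else 0)"

text \<open>
  The arguments of interest satisfy \<open>y \<le> weight x\<close> and \<open>z \<le> length x\<close>, and the recursion stays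
  within this range; the last equation is outside it and only makes the function total.
\<close>

function f :: "word \<Rightarrow> nat \<Rightarrow> nat \<Rightarrow> real" where
  "f x y 0 = f0 x y"
| "f (x @ [One]) 0 (Suc z) = f (x @ [One]) 0 0"
| "f (x @ [One]) (Suc y) (Suc z) = f (x @ [One]) (Suc y) 0 + f x y z"
| "f (x @ [Two]) y (Suc z) =
     (if y = 1 then 0 else f (x @ [One, One]) y (Suc z + 1) / (1 - real y))"
| "f [] y (Suc z) = 0"
proof -
  fix P :: bool and a :: "word \<times> nat \<times> nat"
  assume
    1: "\<And>x y. a = (x, y, 0) \<Longrightarrow> P" and
    2: "\<And>x z. a = (x @ [One], 0, Suc z) \<Longrightarrow> P" and
    3: "\<And>x y z. a = (x @ [One], Suc y, Suc z) \<Longrightarrow> P" and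
    4: "\<And>x y z. a = (x @ [Two], y, Suc z) \<Longrightarrow> P" and
    5: "\<And>y z. a = ([], y, Suc z) \<Longrightarrow> P"
  obtain x y z where a: "a = (x, y, z)"
    by (cases a)
  show P
  proof (cases z)
    case 0
    then show P using a 1 by simp
  next
    case (Suc z')
    show P
    proof (cases x rule: rev_cases)
      case Nil
      then show P using a Suc 5 by simp
    next
      case (snoc x' c)
      then show P using a Suc 2 3 4 by (cases c; cases y) auto
    qed
  qed
qed auto
termination
  by (relation "measures [\<lambda>(x, y, z). weight x, \<lambda>(x, y, z). num_twos x, \<lambda>(x, y, z). z]") auto

section \<open>The function \<open>g\<close>\<close>

text \<open>
  \<open>beta y i\<close> is the exponent \<open>\<beta>\<^sub>i\<close> in \<open>y = 1\<^bsup>\<beta> d\<^esup> 2 1\<^bsup>\<beta> (d-1)\<^esup> 2 \<dots> 2 1\<^bsup>\<beta> 0\<^esup>\<close> with \<open>d = num_twos y\<close>;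
  see \<open>beta_decomposition\<close> and \<open>beta_unique\<close>.
\<close>

fun beta :: "word \<Rightarrow> nat \<Rightarrow> nat" where
  "beta [] i = 0"
| "beta (One # y) i = (if i = num_twos y then Suc (beta y i) else beta y i)"
| "beta (Two # y) i = beta y i"

primrec beta_word :: "(nat \<Rightarrow> nat) \<Rightarrow> nat \<Rightarrow> word" where
  "beta_word b 0 = replicate (b 0) One"
| "beta_word b (Suc d) = replicate (b (Suc d)) One @ Two # beta_word b d"

lemma beta_word_cong: "(\<And>i. i \<le> d \<Longrightarrow> b i = c i) \<Longrightarrow> beta_word b d = beta_word c d"
  by (induction d) auto

lemma beta_beyond: "num_twos y < i \<Longrightarrow> beta y i = 0"
  by (induction y i rule: beta.induct) auto

lemma beta_decomposition: "y = beta_word (beta y) (num_twos y)"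
proof (induction y)
  case (Cons c y)
  show ?case
  proof (cases c)
    case One
    have "beta_word (beta (One # y)) (num_twos y) = One # beta_word (beta y) (num_twos y)"
    proof (cases "num_twos y")
      case (Suc d)
      have "beta_word (beta (One # y)) d = beta_word (beta y) d"
        by (rule beta_word_cong) (use Suc in auto)
      then show ?thesis using Suc by simp
    qed simp
    then show ?thesis unfolding One num_twos_simps using Cons.IH by metis
  next
    case Two
    have "beta_word (beta (Two # y)) (num_twos y) = beta_word (beta y) (num_twos y)"
      by (rule beta_word_cong) simp
    then have "beta_word (beta (Two # y)) (Suc (num_twos y)) = Two # beta_word (beta y) (num_twos y)"
      by (simp add: beta_beyond)
    then show ?thesis unfolding Two num_twos_simps using Cons.IH by metis
  qed
qed simp

lemma num_twos_replicate_One [simp]: "num_twos (replicate n One) = 0"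
  by (induction n) auto

lemma num_twos_beta_word [simp]: "num_twos (beta_word b d) = d"
  by (induction d) auto

lemma beta_replicate_One_append:
  "beta (replicate n One @ y) i = (if i = num_twos y then n + beta y i else beta y i)"
  by (induction n) auto

lemma beta_unique:
  assumes "i \<le> d"
  shows "beta (beta_word b d) i = b i"
  using assms
proof (induction d)
  case 0
  then show ?case using beta_replicate_One_append[of "b 0" "[]" i] by simp
next
  case (Suc d)
  then show ?case by (cases "i = Suc d") (simp_all add: beta_replicate_One_append beta_beyond)
qed

definition g :: "word \<Rightarrow> nat \<Rightarrow> nat" where
  "g y m = (\<Sum>i<m. beta y i) + 2 * m - 1"

end

theory Submission
  imports Defs
begin

text \<open>
  Put \<open>Q\<^sub>y(t) = \<Prod>\<^sub>j (g(y,j) - t)\<close>. Then \<open>\<Sum>\<^sub>i f(x,i,0) Q\<^sub>y(i)\<close> is, up to sign, the divided difference of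
  \<open>Q\<^sub>y\<close> at the digit sums of the suffixes of \<open>x\<close>. As \<open>Q\<^bsub>2y\<^esub>(t) = (|y| + 1 - t) Q\<^sub>y(t)\<close>, the Leibniz rule
  shows that it satisfies the recurrences
  \<open>d(x,1y) = d(x,y)\<close> and \<open>d(x,2y) = (|y| + 1 - |x|) d(x,y) + d(x',y)\<close>, where \<open>x'\<close> is \<open>x\<close> without its
  first digit (and the last term is absent for empty \<open>x\<close>). The path numbers satisfy the same recurrences,
  because the lower neighbours of \<open>2y\<close> are \<open>1y\<close> and the words \<open>2w\<close> with \<open>w\<close> a lower neighbour of \<open>y\<close>.
  Removing a common last digit adds to the formula further divided differences, which satisfy the
  recurrences too. So it remains to compare the two sides for \<open>|x| = |y|\<close>. There, no divided difference
  that occurs belongs to a pair of words consisting of twos only; hence the degree of its polynomial is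
  less than its number of nodes minus one, and it vanishes. What is left is the contribution 1 of the
  pair of empty words, which is reached only if \<open>x = y\<close>.
\<close>

section \<open>Counting paths\<close>

lemma digit_val_neq_0 [simp]: "digit_val a \<noteq> 0"
  by (cases a) simp_all

lemma yf_up_Nil [simp]: "\<not> yf_up w []"
  by (auto elim: yf_up.cases)

lemma yf_up_One [simp]: "yf_up w (One # v) \<longleftrightarrow> w = v"
proof
  assume "yf_up w (One # v)"
  then show "w = v"
  proof cases
    case (replace k u)
    then show ?thesis by (cases k) auto
  next
    case (insert k u)
    then show ?thesis by (cases k) auto
  qed
next
  assume "w = v"
  then show "yf_up w (One # v)"
    using yf_up.insert[of 0 v] by simp
qed

text \<open>For \<open>k = 0\<close> only \<open>replace\<close> can yield a leading 2, which gives
  \<open>One # v\<close>. For positive \<open>k\<close> the first 2 is shared by both words, and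
  removing it leaves an edge.\<close>

lemma yf_up_Two [simp]: "yf_up w (Two # v) \<longleftrightarrow> w = One # v \<or> (\<exists>u. w = Two # u \<and> yf_up u v)"
proof
  assume "yf_up w (Two # v)"
  then show "w = One # v \<or> (\<exists>u. w = Two # u \<and> yf_up u v)"
  proof cases
    case (replace k u)
    then show ?thesis by (cases k) (auto intro: yf_up.replace)
  next
    case (insert k u)
    then show ?thesis by (cases k) (auto intro: yf_up.insert)
  qed
next
  have "yf_up (One # v) (Two # v)"
    using yf_up.replace[of 0 v] by simp
  moreover have "yf_up (Two # u) (Two # v)" if "yf_up u v" for u
    using that
  proof cases
    case (replace k u')
    then show ?thesis using yf_up.replace[of "Suc k" u'] by simp
  next
    case (insert k u')
    then show ?thesis using yf_up.insert[of "Suc k" u'] by simp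
  qed
  ultimately show "yf_up w (Two # v)" if "w = One # v \<or> (\<exists>u. w = Two # u \<and> yf_up u v)"
    using that by blast
qed

definition lower :: "word \<Rightarrow> word set" where
  "lower y = {w. yf_up w y}"

lemma lower_simps [simp]:
  "lower [] = {}"
  "lower (One # v) = {v}"
  "lower (Two # v) = insert (One # v) ((#) Two ` lower v)"
  by (auto simp: lower_def)

lemma finite_lower [simp]: "finite (lower y)"
proof (induction y)
  case (Cons c y)
  then show ?case by (cases c) auto
qed simp

lemma weight_lower: "w \<in> lower y \<Longrightarrow> weight y = Suc (weight w)"
  by (simp add: lower_def weight_yf_up)

section \<open>First-step recursion and recurrences for path numbers\<close>

lemma num_paths_same_weight:
  assumes "weight x = weight y"
  shows "num_paths x y = of_bool (x = y)"
proof -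
  have "{p. downward_path y x p} = (if x = y then {[y]} else {})"
    using assms by (auto simp: downward_path_def length_Suc_conv)
  then show ?thesis
    by (simp add: num_paths_def)
qed

lemma downward_path_Cons:
  assumes "weight x < weight y"
  shows "downward_path y x p \<longleftrightarrow> (\<exists>w\<in>lower y. \<exists>q. p = y # q \<and> downward_path w x q)"
proof
  assume p: "downward_path y x p"
  obtain n where n: "weight y - weight x = Suc n"
    using assms by (metis Suc_diff_Suc)
  from p n obtain q where q: "p = y # q" "length q = Suc n"
    unfolding downward_path_def by (cases p) auto
  define w where "w = q ! 0"
  have "yf_adjacent y w"
    using p n q unfolding downward_path_def w_def by force
  moreover have "weight w = weight y - 1"
    using p n q unfolding downward_path_def w_def by force
  \<comment> \<open>\<open>yf_adjacent\<close> is symmetric; the prescribed weight of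
    \<open>w\<close> rules out the upward direction.\<close>
  ultimately have up: "yf_up w y"
    using weight_yf_up[of y w] unfolding yf_adjacent_def by auto
  then have wy: "weight y = Suc (weight w)"
    by (rule weight_yf_up)
  then have wn: "weight w - weight x = n"
    using n by simp
  have "downward_path w x q"
    unfolding downward_path_def wn
  proof (intro conjI allI impI)
    show "q ! n = x"
      using p n q unfolding downward_path_def by simp
    show "yf_adjacent (q ! i) (q ! Suc i)" if "i < n" for i
      using p n q that unfolding downward_path_def by force
    show "weight (q ! i) = weight w - i" if "i \<le> n" for i
    proof -
      have "weight (p ! Suc i) = weight y - Suc i"
        using p n that unfolding downward_path_def by simp
      then show ?thesis using q wy by simp
    qed
  qed (use q w_def in simp_all)
  then show "\<exists>w\<in>lower y. \<exists>q. p = y # q \<and> downward_path w x q"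
    using up q by (auto simp: lower_def)
next
  assume "\<exists>w\<in>lower y. \<exists>q. p = y # q \<and> downward_path w x q"
  then obtain w q where w: "w \<in> lower y" and p: "p = y # q" and q: "downward_path w x q"
    by blast
  have wy: "weight y = Suc (weight w)"
    using w by (rule weight_lower)
  then have n: "weight y - weight x = Suc (weight w - weight x)"
    using assms by simp
  show "downward_path y x p"
    unfolding downward_path_def n
  proof (intro conjI allI impI)
    show "yf_adjacent (p ! i) (p ! Suc i)" if "i < Suc (weight w - weight x)" for i
    proof (cases i)
      case 0
      then show ?thesis
        using q w p by (auto simp: downward_path_def yf_adjacent_def lower_def)
    next
      case (Suc j)
      then show ?thesis using q p that by (auto simp: downward_path_def)
    qed
    show "weight (p ! i) = weight y - i" if "i \<le> Suc (weight w - weight x)" for i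
      using q p that wy by (cases i) (auto simp: downward_path_def)
  qed (use p q in \<open>auto simp: downward_path_def\<close>)
qed

lemma num_paths_lower:
  assumes "weight x < weight y"
  shows "num_paths x y = (\<Sum>w\<in>lower y. num_paths x w)"
proof -
  have "{p. downward_path y x p} = (\<Union>w\<in>lower y. (#) y ` {q. downward_path w x q})"
    by (auto simp: downward_path_Cons[OF assms])
  moreover have "card (\<Union>w\<in>lower y. (#) y ` {q. downward_path w x q}) =
      (\<Sum>w\<in>lower y. card ((#) y ` {q. downward_path w x q}))"
    by (rule card_UN_disjoint)
      (simp_all add: finite_downward_paths, auto simp: downward_path_def)
  moreover have "card ((#) y ` A) = card A" for A :: "word list set"
    by (rule card_image) simp
  ultimately show ?thesis
    by (simp add: num_paths_def)
qed

lemma num_paths_One: "weight x \<le> weight y \<Longrightarrow> num_paths x (One # y) = num_paths x y"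
  by (simp add: num_paths_lower)

lemma num_paths_Two_split:
  assumes "weight x \<le> Suc (weight y)"
  shows "num_paths x (Two # y) = num_paths x (One # y) + (\<Sum>w\<in>lower y. num_paths x (Two # w))"
proof -
  have "num_paths x (Two # y) = num_paths x (One # y) + (\<Sum>w\<in>(#) Two ` lower y. num_paths x w)"
    using assms by (subst num_paths_lower, simp, simp, subst sum.insert) auto
  also have "(\<Sum>w\<in>(#) Two ` lower y. num_paths x w) = (\<Sum>w\<in>lower y. num_paths x (Two # w))"
    by (subst sum.reindex) auto
  finally show ?thesis .
qed

text \<open>Each \<open>w\<close> in \<open>lower y\<close> gives the factor
  \<open>weight w + 1 = weight y\<close>, and the remaining lower neighbour \<open>One # y\<close>
  supplies one more copy of \<open>num_paths [] y\<close>.\<close>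

lemma num_paths_Nil_Two: "num_paths [] (Two # y) = Suc (weight y) * num_paths [] y"
proof (induction "weight y" arbitrary: y)
  case 0
  then have "y = []" using length_le_weight[of y] by simp
  then show ?case by (simp add: num_paths_Two_split num_paths_One num_paths_same_weight)
next
  case (Suc n)
  have "num_paths [] (Two # w) = weight y * num_paths [] w" if "w \<in> lower y" for w
    using Suc weight_lower[OF that] by simp
  then have "num_paths [] (Two # y) = num_paths [] y + weight y * (\<Sum>w\<in>lower y. num_paths [] w)"
    by (subst num_paths_Two_split) (simp_all add: num_paths_One sum_distrib_left)
  also have "(\<Sum>w\<in>lower y. num_paths [] w) = num_paths [] y"
    using Suc.hyps(2) by (simp add: num_paths_lower[of "[]" y])
  finally show ?case by simp
qed

text \<open>The induction hypothesis for \<open>w\<close> in \<open>lower y\<close> has the factor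
  \<open>weight y - weight x\<close>; the neighbour \<open>One # y\<close> raises it by one.\<close>

lemma num_paths_Two:
  assumes "x \<noteq> []" "weight x \<le> Suc (weight y)"
  shows "real (num_paths x (Two # y)) =
    (real (weight y) + 1 - real (weight x)) * real (num_paths x y) + real (num_paths (tl x) y)"
  using assms(2)
proof (induction "weight y" arbitrary: y rule: less_induct)
  case less
  obtain c v where x: "x = c # v"
    using assms(1) by (cases x) auto
  have v: "weight v < weight x"
    by (simp add: x)
  show ?case
  proof (cases "weight x = Suc (weight y)")
    case True
    \<comment> \<open>The factor is 0 here, so it remains to see that \<open>num_paths v y\<close>
      also decides whether \<open>x\<close> lies directly below \<open>Two # y\<close>.\<close>
    have "num_paths x (Two # y) = of_bool (x \<in> lower (Two # y))"
    proof -
      have "num_paths x w = of_bool (x = w)" if "w \<in> lower (Two # y)" for w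
        using weight_lower[OF that] True by (simp add: num_paths_same_weight)
      then have "num_paths x (Two # y) = (\<Sum>w\<in>lower (Two # y). of_bool (x = w))"
        using True by (simp add: num_paths_lower)
      also have "\<dots> = of_bool (x \<in> lower (Two # y))"
        using finite_lower[of "Two # y"] by (simp del: lower_simps add: of_bool_def)
      finally show ?thesis .
    qed
    moreover have "num_paths v y = of_bool (x \<in> lower (Two # y))"
    proof (cases c)
      case One
      then show ?thesis using True x by (auto simp: num_paths_same_weight)
    next
      case Two
      have "num_paths v w = of_bool (v = w)" if "w \<in> lower y" for w
        using weight_lower[OF that] True Two x by (simp add: num_paths_same_weight)
      then have "num_paths v y = (\<Sum>w\<in>lower y. of_bool (v = w))"
        using True Two x by (simp add: num_paths_lower)
      also have "\<dots> = of_bool (v \<in> lower y)"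
        by (simp add: of_bool_def)
      finally show ?thesis using Two x by auto
    qed
    ultimately show ?thesis using True x by simp
  next
    case False
    then have le: "weight x \<le> weight y"
      using less.prems by simp
    have "real (num_paths x (Two # w)) =
        (real (weight y) - real (weight x)) * real (num_paths x w) + real (num_paths v w)"
      if "w \<in> lower y" for w
      using less.hyps[of w] weight_lower[OF that] le x by simp
    then have "real (num_paths x (Two # y)) = real (num_paths x y) +
        ((real (weight y) - real (weight x)) * real (\<Sum>w\<in>lower y. num_paths x w) +
         real (\<Sum>w\<in>lower y. num_paths v w))"
      using le by (subst num_paths_Two_split) (simp_all add: num_paths_One sum_distrib_left sum.distrib)
    also have "(\<Sum>w\<in>lower y. num_paths v w) = num_paths v y"
      using le v by (simp add: num_paths_lower[of v y])
    \<comment> \<open>For \<open>weight x = weight y\<close> the factor is 0; otherwise this is the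
      first-step recursion.\<close>
    also have "(real (weight y) - real (weight x)) * real (\<Sum>w\<in>lower y. num_paths x w) =
        (real (weight y) - real (weight x)) * real (num_paths x y)"
      using le by (cases "weight x = weight y") (simp_all add: num_paths_lower[of x y])
    finally show ?thesis
      using x by (simp add: algebra_simps)
  qed
qed

section \<open>Divided differences\<close>

text \<open>Up to the sign \<open>(-1) ^ (card A - 1)\<close> this is the divided difference of \<open>q\<close> at the nodes \<open>A\<close>.\<close>

definition divdiff :: "real set \<Rightarrow> (real \<Rightarrow> real) \<Rightarrow> real" where
  "divdiff A q = (\<Sum>a\<in>A. q a / (\<Prod>b\<in>A - {a}. b - a))"

lemma divdiff_linear: "divdiff A (\<lambda>t. c * q t + r t) = c * divdiff A q + divdiff A r"
  by (simp add: divdiff_def add_divide_distrib sum.distrib sum_distrib_left)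

text \<open>The Leibniz rule for a linear factor: \<open>p - t\<close> kills the term of the node
  \<open>p\<close> and cancels one factor of every other denominator.\<close>

lemma divdiff_remove:
  assumes "finite A" "p \<in> A"
  shows "divdiff A (\<lambda>t. (p - t) * q t) = divdiff (A - {p}) q"
proof -
  have "divdiff A (\<lambda>t. (p - t) * q t) =
      (\<Sum>a\<in>A - {p}. (p - a) * q a / (\<Prod>b\<in>A - {a}. b - a))"
    unfolding divdiff_def using assms by (simp add: sum.remove)
  also have "\<dots> = (\<Sum>a\<in>A - {p}. q a / (\<Prod>b\<in>A - {p} - {a}. b - a))"
  proof (rule sum.cong[OF refl])
    fix a assume a: "a \<in> A - {p}"
    then have "(\<Prod>b\<in>A - {a}. b - a) = (p - a) * (\<Prod>b\<in>A - {a} - {p}. b - a)"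
      using assms by (intro prod.remove) auto
    moreover have "A - {a} - {p} = A - {p} - {a}"
      by blast
    ultimately show "(p - a) * q a / (\<Prod>b\<in>A - {a}. b - a) = q a / (\<Prod>b\<in>A - {p} - {a}. b - a)"
      using a by simp
  qed
  finally show ?thesis by (simp add: divdiff_def)
qed

text \<open>For distinct nodes \<open>p\<close> and \<open>q\<close>, removing either one gives the
  same value, by induction or because a single node remains. So \<open>p - t\<close> and
  \<open>q - t\<close> have equal divided differences, though they differ by the nonzero constant
  \<open>q - p\<close>.\<close>

lemma divdiff_const:
  assumes "finite A" "2 \<le> card A"
  shows "divdiff A (\<lambda>t. 1) = 0"
  using assms
proof (induction "card A" arbitrary: A rule: less_induct)
  case less
  obtain p where p: "p \<in> A"
    using less.prems by fastforce
  have "A \<noteq> {p}"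
    using less.prems by auto
  then obtain q where q: "q \<in> A" "q \<noteq> p"
    using p by blast
  have eq: "divdiff (A - {r}) (\<lambda>t. 1) = (if card A = 2 then 1 else 0)" if "r \<in> A" for r
  proof (cases "card A = 2")
    case True
    then have "card (A - {r}) = 1"
      using that less.prems by (simp add: card_Diff_singleton)
    then obtain s where "A - {r} = {s}"
      using card_1_singletonE by blast
    then show ?thesis using True by (simp add: divdiff_def)
  next
    case False
    then show ?thesis
      using less.hyps[of "A - {r}"] less.prems that by (simp add: card_Diff_singleton)
  qed
  have "(q - p) * divdiff A (\<lambda>t. 1) + divdiff A (\<lambda>t. p - t) = divdiff A (\<lambda>t. q - t)"
    by (simp flip: divdiff_linear)
  then have "(q - p) * divdiff A (\<lambda>t. 1) = 0"
    using divdiff_remove[of A p "\<lambda>t. 1"] divdiff_remove[of A q "\<lambda>t. 1"] less.prems p q eq by simp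
  then show ?case using q by simp
qed

section \<open>The functions of the formula\<close>

definition suffix_weights :: "word \<Rightarrow> real set" where
  "suffix_weights x = (\<lambda>k. real (weight (drop k x))) ` {..length x}"

lemma suffix_weights_Nil [simp]: "suffix_weights [] = {0}"
  by (simp add: suffix_weights_def)

lemma suffix_weights_Cons [simp]:
  "suffix_weights (c # x) = insert (real (weight (c # x))) (suffix_weights x)"
  unfolding suffix_weights_def by (simp add: atMost_Suc_eq_insert_0 image_image)

lemma suffix_weights_le: "a \<in> suffix_weights x \<Longrightarrow> a \<le> real (weight x)"
  by (induction x) auto

lemma suffix_weights_nonneg: "a \<in> suffix_weights x \<Longrightarrow> 0 \<le> a"
  by (induction x) auto

lemma weight_Cons_notin: "real (weight (c # x)) \<notin> suffix_weights x"
proof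
  assume "real (weight (c # x)) \<in> suffix_weights x"
  from suffix_weights_le[OF this] show False
    by (cases c) auto
qed

lemma finite_suffix_weights [simp]: "finite (suffix_weights x)"
  by (simp add: suffix_weights_def)

lemma card_suffix_weights: "card (suffix_weights x) = Suc (length x)"
proof (induction x)
  case (Cons c x)
  then show ?case using weight_Cons_notin[of c x] by simp
qed simp

lemma suffix_weights_snoc_One:
  "suffix_weights (x @ [One]) = insert 0 ((+) 1 ` suffix_weights x)"
  by (induction x) (auto simp: insert_commute)

lemma weight_drop_Suc: "k < length x \<Longrightarrow> weight (drop k x) = digit_val (x ! k) + weight (drop (Suc k) x)"
  by (metis Cons_nth_drop_Suc weight_simps(2))

lemma sum_alpha:
  assumes "m \<le> k" "k \<le> length x"
  shows "(\<Sum>i = m + 1..k. alpha x i) = real (weight (drop m x)) - real (weight (drop k x))"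
  using assms
proof (induction k rule: dec_induct)
  case (step k)
  then show ?case
    using weight_drop_Suc[of k x] by (simp add: alpha_def)
qed simp

lemma inj_on_weight_drop: "inj_on (\<lambda>k. real (weight (drop k x))) {..length x}"
  \<comment> \<open>As many nodes as indices, so no two indices share a node.\<close>
  using card_suffix_weights[of x] by (simp add: suffix_weights_def eq_card_imp_inj_on)

text \<open>By \<open>sum_alpha\<close> both products in \<open>f0\<close> have factors
  \<open>?w k - ?w m\<close>: those with \<open>k > m\<close> in the first, those with
  \<open>k < m\<close> in the second. Together they exhaust the other nodes.\<close>

lemma f0_split:
  assumes m: "m \<le> length x"
  shows "f0 x (weight (drop m x)) =
    1 / (\<Prod>b\<in>suffix_weights x - {real (weight (drop m x))}. b - real (weight (drop m x)))"
proof -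
  let ?n = "length x" and ?w = "\<lambda>k. real (weight (drop k x))"
  have split: "is_split x (weight (drop m x)) m"
    using m by (simp add: is_split_def)
  then have the: "(THE m'. is_split x (weight (drop m x)) m') = m"
    using is_split_unique by blast
  have "(\<Prod>k = m + 1..?n. - (\<Sum>i = m + 1..k. alpha x i)) = (\<Prod>k = m + 1..?n. ?w k - ?w m)"
    by (rule prod.cong[OF refl], subst sum_alpha) auto
  moreover have "(\<Prod>k = 1..m. \<Sum>i = k..m. alpha x i) = (\<Prod>k<m. ?w k - ?w m)"
  proof -
    have "(\<Prod>k = 1..m. \<Sum>i = k..m. alpha x i) = (\<Prod>k<m. \<Sum>i = k + 1..m. alpha x i)"
      by (rule prod.reindex_bij_witness[of _ Suc "\<lambda>k. k - 1"]) auto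
    also have "\<dots> = (\<Prod>k<m. ?w k - ?w m)"
      using m by (intro prod.cong refl sum_alpha) auto
    finally show ?thesis .
  qed
  moreover have "(\<Prod>k = m + 1..?n. ?w k - ?w m) * (\<Prod>k<m. ?w k - ?w m) =
      (\<Prod>k\<in>{..?n} - {m}. ?w k - ?w m)"
  proof -
    have eq: "{..?n} - {m} = {m + 1..?n} \<union> {..<m}"
      using m by auto
    show ?thesis
      unfolding eq by (rule prod.union_disjoint[symmetric]) auto
  qed
  moreover have "(\<Prod>k\<in>{..?n} - {m}. ?w k - ?w m) = (\<Prod>b\<in>suffix_weights x - {?w m}. b - ?w m)"
  proof -
    have "suffix_weights x - {?w m} = ?w ` ({..?n} - {m})"
      unfolding suffix_weights_def
      using inj_on_image_set_diff[OF inj_on_weight_drop[of x], of "{..?n}" "{m}"] m by simp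
    moreover have "inj_on ?w ({..?n} - {m})"
      using inj_on_weight_drop by (rule inj_on_subset) auto
    ultimately show ?thesis
      by (simp add: prod.reindex)
  qed
  ultimately show ?thesis
    using split unfolding f0_def the by (auto simp: Let_def)
qed

lemma f0_eq_0: "real i \<notin> suffix_weights x \<Longrightarrow> f0 x i = 0"
  by (auto simp: f0_def is_split_def suffix_weights_def)

lemma f0_eq:
  "f0 x i = (if real i \<in> suffix_weights x
    then 1 / (\<Prod>b\<in>suffix_weights x - {real i}. b - real i) else 0)"
proof (cases "real i \<in> suffix_weights x")
  case True
  then obtain m where "m \<le> length x" "i = weight (drop m x)"
    by (auto simp: suffix_weights_def)
  then show ?thesis
    using f0_split True by simp
qed (simp add: f0_eq_0)

lemma sum_f0: "(\<Sum>i = 0..weight x. f0 x i * q (real i)) = divdiff (suffix_weights x) q"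
proof -
  have sub: "suffix_weights x \<subseteq> real ` {0..weight x}"
  proof
    fix a
    assume a: "a \<in> suffix_weights x"
    then obtain k where "a = real (weight (drop k x))"
      by (auto simp: suffix_weights_def)
    then show "a \<in> real ` {0..weight x}"
      using suffix_weights_le[OF a] by simp
  qed
  have "divdiff (suffix_weights x) q =
      (\<Sum>a\<in>real ` {0..weight x}. if a \<in> suffix_weights x
        then q a / (\<Prod>b\<in>suffix_weights x - {a}. b - a) else 0)"
    unfolding divdiff_def using sub
    by (subst sum.inter_restrict[symmetric]) (auto simp: Int_absorb1)
  also have "\<dots> = (\<Sum>i = 0..weight x. f0 x i * q (real i))"
    by (subst sum.reindex) (auto simp: f0_eq intro!: sum.cong)
  finally show ?thesis by simp
qed

text \<open>With S the nodes of \<open>x\<close>, \<open>x1\<close> has the nodes 0 and S + 1, and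
  \<open>x11\<close> has 0, 1 and S + 2. Seen from the node 1 of \<open>x11\<close>, the extra node
  0 contributes the factor -1; the other factors agree.\<close>

lemma f0_snoc_One_One: "f0 (x @ [One, One]) 1 + f0 (x @ [One]) 0 = 0"
proof -
  let ?S = "suffix_weights x"
  have S2: "suffix_weights (x @ [One, One]) = insert 0 (insert 1 ((+) 2 ` ?S))"
    using suffix_weights_snoc_One[of "x @ [One]"]
    by (simp add: suffix_weights_snoc_One image_image)
  have pos: "a \<notin> (+) b ` ?S" if "a < b" for a b
    using that suffix_weights_nonneg by fastforce
  have "(\<Prod>b\<in>suffix_weights (x @ [One]) - {0}. b - 0) = (\<Prod>b\<in>?S. b + 1)"
    using pos[of 0 1] by (simp add: suffix_weights_snoc_One prod.reindex add.commute)
  moreover have "(\<Prod>b\<in>suffix_weights (x @ [One, One]) - {1}. b - 1) = - (\<Prod>b\<in>?S. b + 1)"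
  proof -
    have "suffix_weights (x @ [One, One]) - {1} = insert 0 ((+) 2 ` ?S)"
      using pos[of 1 2] unfolding S2 by auto
    then show ?thesis
      using pos[of 0 2] by (simp add: prod.reindex add.commute)
  qed
  ultimately show ?thesis
    by (simp add: f0_eq S2 suffix_weights_snoc_One)
qed

section \<open>The product over the values of \<open>g\<close>, built from the left\<close>

primrec gprod :: "word \<Rightarrow> real \<Rightarrow> real" where
  "gprod [] t = 1"
| "gprod (c # y) t = (if c = Two then (real (weight y) + 1 - t) * gprod y t else gprod y t)"

text \<open>A new last digit raises all earlier values of \<open>g\<close> by its weight, and a last
  2 has the value 1 itself.\<close>

lemma gprod_snoc [simp]:
  "gprod (y @ [One]) t = gprod y (t - 1)"
  "gprod (y @ [Two]) t = (1 - t) * gprod y (t - 2)"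
  by (induction y) auto

lemma weight_beta: "weight y = (\<Sum>i\<le>num_twos y. beta y i) + 2 * num_twos y"
proof (induction y)
  case (Cons c y)
  show ?case
  proof (cases c)
    case One
    have "(\<Sum>i\<le>num_twos y. beta (One # y) i) = Suc (\<Sum>i\<le>num_twos y. beta y i)"
      by (simp add: sum.remove[of _ "num_twos y"])
    then show ?thesis using One Cons by simp
  next
    case Two
    then show ?thesis using Cons by (simp add: beta_beyond)
  qed
qed simp

text \<open>A leading 1 alters only \<open>beta\<close> at index \<open>num_twos y\<close>, which no
  factor uses. A leading 2 adds the factor for \<open>j = num_twos y + 1\<close>, where
  \<open>weight_beta\<close> gives the value \<open>weight y + 1\<close>.\<close>

lemma prod_g: "(\<Prod>j = 1..num_twos y. real (g y j) - t) = gprod y t"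
proof (induction y)
  case (Cons c y)
  show ?case
  proof (cases c)
    case One
    have "g (One # y) j = g y j" if "j \<in> {1..num_twos y}" for j
      using that by (auto simp: g_def)
    then show ?thesis using One Cons by simp
  next
    case Two
    have "g (Two # y) j = g y j" for j
      by (simp add: g_def)
    moreover have "g y (Suc (num_twos y)) = Suc (weight y)"
      by (simp add: g_def weight_beta lessThan_Suc_atMost)
    ultimately show ?thesis using Two Cons by (simp add: algebra_simps)
  qed
qed simp

section \<open>Longest common suffixes\<close>

lemma common_suffix_len_Nil [simp]: "common_suffix_len [] y = 0" "common_suffix_len x [] = 0"
  by (simp_all add: common_suffix_len_def)

lemma common_suffix_len_snoc [simp]:
  "common_suffix_len (x @ [a]) (y @ [b]) = (if a = b then Suc (common_suffix_len x y) else 0)"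
proof -
  let ?L = "\<lambda>x y. {length w |w. suffix w x \<and> suffix w y}"
  have fin: "finite (?L x y)" for x y :: word
  proof (rule finite_subset)
    show "?L x y \<subseteq> {..length x}"
      by (auto dest: suffix_length_le)
  qed simp
  have "?L (x @ [a]) (y @ [b]) = (if a = b then insert 0 (Suc ` ?L x y) else {0})"
  proof (rule set_eqI)
    fix n
    show "n \<in> ?L (x @ [a]) (y @ [b]) \<longleftrightarrow> n \<in> (if a = b then insert 0 (Suc ` ?L x y) else {0})"
      by (auto simp: image_iff) (metis length_append_singleton)+
  qed
  moreover have "0 \<in> ?L x y"
    by (intro CollectI exI[of _ "[]"]) simp
  then have "?L x y \<noteq> {}"
    by blast
  then have "Max (insert 0 (Suc ` ?L x y)) = Suc (Max (?L x y))"
    using mono_Max_commute[of Suc "?L x y"] fin[of x y] by (simp add: mono_def)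
  ultimately show ?thesis
    by (simp add: common_suffix_len_def)
qed

section \<open>The right-hand side of the formula\<close>

definition f_sum :: "word \<Rightarrow> word \<Rightarrow> nat \<Rightarrow> real" where
  "f_sum x y z = (\<Sum>i = 0..weight x. f x i z * gprod y (real i))"

definition f0_sum :: "word \<Rightarrow> word \<Rightarrow> real" where
  "f0_sum x y = divdiff (suffix_weights x) (gprod y)"

lemma f_sum_0: "f_sum x y 0 = f0_sum x y"
  by (simp add: f_sum_def f0_sum_def sum_f0)

text \<open>The index shift in the recursion of \<open>f\<close> matches the shift of the argument
  in \<open>gprod_snoc\<close>; the term \<open>i = 0\<close> has no recursive part.\<close>

lemma f_sum_One: "f_sum (x @ [One]) (y @ [One]) (Suc z) = f0_sum (x @ [One]) (y @ [One]) + f_sum x y z"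
proof -
  let ?x = "x @ [One]" and ?y = "y @ [One]"
  have split: "(\<Sum>i = 0..weight ?x. u i) = u 0 + (\<Sum>i = 0..weight x. u (Suc i))" for u :: "nat \<Rightarrow> real"
    using sum.atLeast0_atMost_Suc_shift[of u "weight x"] by simp
  have "f_sum ?x ?y (Suc z) = f_sum ?x ?y 0 + f_sum x y z"
    unfolding f_sum_def split by (simp add: distrib_right sum.distrib)
  then show ?thesis by (simp add: f_sum_0)
qed

text \<open>
  The two contributions to \<open>f(x11,1,z+2)\<close> cancel, so the value \<open>f(x2,1,z+1) = 0\<close> is consistent with
  \<open>(1 - i) f(x2,i,z+1) = f(x11,i,z+2)\<close>.
\<close>

lemma f_sum_Two:
  "f_sum (x @ [Two]) (y @ [Two]) (Suc z) =
    f0_sum (x @ [One, One]) (y @ [One, One]) + f0_sum (x @ [One]) (y @ [One]) + f_sum x y z"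
proof -
  have "f ((x @ [One]) @ [One]) (Suc 0) (Suc (Suc z)) = 0"
    using f0_snoc_One_One[of x] by (simp only: f.simps) simp
  then have f1: "f (x @ [One, One]) 1 (Suc z + 1) = 0"
    by simp
  have "gprod (y @ [One, One]) t = gprod y (t - 2)" for t
    using gprod_snoc(1)[of "y @ [One]"] by (simp add: algebra_simps)
  \<comment> \<open>For \<open>i\<close> other than 1, the factor \<open>1 - i\<close> of
    \<open>gprod (y @ [Two])\<close> cancels the denominator in \<open>f\<close>.\<close>
  then have "f (x @ [Two]) i (Suc z) * gprod (y @ [Two]) (real i) =
      f (x @ [One, One]) i (Suc z + 1) * gprod (y @ [One, One]) (real i)" for i
    using f1 by (simp add: field_simps)
  then have "f_sum (x @ [Two]) (y @ [Two]) (Suc z) = f_sum (x @ [One, One]) (y @ [One, One]) (Suc z + 1)"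
    by (simp add: f_sum_def)
  then show ?thesis
    using f_sum_One[of "x @ [One]" "y @ [One]" "Suc z"] f_sum_One[of x y z] by simp
qed

section \<open>Recurrences and vanishing of the divided differences\<close>

lemma f0_sum_One [simp]: "f0_sum x (One # y) = f0_sum x y"
proof -
  have "gprod (One # y) = gprod y" by auto
  then show ?thesis by (simp add: f0_sum_def)
qed

lemma f0_sum_Nil: "f0_sum [] y = gprod y 0"
  by (simp add: f0_sum_def divdiff_def)

lemma f0_sum_Nil_Two: "f0_sum [] (Two # y) = (real (weight y) + 1) * f0_sum [] y"
  by (simp add: f0_sum_Nil)

text \<open>Write the new factor as a constant plus \<open>weight x - t\<close>; removing the
  largest node \<open>weight x\<close> leaves the nodes of \<open>tl x\<close>.\<close>

lemma f0_sum_Two: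
  assumes "x \<noteq> []"
  shows "f0_sum x (Two # y) = (real (weight y) + 1 - real (weight x)) * f0_sum x y + f0_sum (tl x) y"
proof -
  obtain c v where x: "x = c # v"
    using assms by (cases x) auto
  have "gprod (Two # y) = (\<lambda>t. (real (weight y) + 1 - real (weight x)) * gprod y t +
      (real (weight x) - t) * gprod y t)"
    by (auto simp: algebra_simps)
  moreover have "suffix_weights x - {real (weight x)} = suffix_weights v"
    using weight_Cons_notin[of c v] x by simp
  then have "divdiff (suffix_weights x) (\<lambda>t. (real (weight x) - t) * gprod y t) = f0_sum v y"
    using x by (subst divdiff_remove) (auto simp: f0_sum_def)
  ultimately show ?thesis
    using x by (simp only: f0_sum_def divdiff_linear list.sel)
qed

text \<open>\<open>gprod y\<close> has degree \<open>num_twos y\<close>, and there are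
  \<open>length x + 1\<close> nodes. In the induction each 2 of \<open>y\<close> costs at most one
  node.\<close>

lemma f0_sum_eq_0: "num_twos y < length x \<Longrightarrow> f0_sum x y = 0"
proof (induction y arbitrary: x)
  case Nil
  then have "divdiff (suffix_weights x) (\<lambda>t. 1) = 0"
    by (intro divdiff_const) (auto simp: card_suffix_weights Suc_le_eq)
  moreover have "gprod [] = (\<lambda>t. 1)" by auto
  ultimately show ?case by (simp add: f0_sum_def)
next
  case (Cons c y)
  show ?case
  proof (cases c)
    case Two
    then have "f0_sum x y = 0" "f0_sum (tl x) y = 0" "x \<noteq> []"
      using Cons by auto
    then show ?thesis using Two by (simp add: f0_sum_Two)
  qed (use Cons in simp)
qed

section \<open>The full formula: initial values and recurrences\<close>

lemma weight_eq_length_num_twos: "weight x = length x + num_twos x"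
proof (induction x)
  case (Cons c x)
  then show ?case by (cases c) auto
qed simp

lemma num_twos_le_length: "num_twos x \<le> length x"
  by (simp add: num_twos_def count_le_length)

definition path_formula :: "word \<Rightarrow> word \<Rightarrow> real" where
  "path_formula x y = f_sum x y (common_suffix_len x y)"

lemma path_formula_Nil: "path_formula [] y = f0_sum [] y" "path_formula x [] = f0_sum x []"
  by (simp_all add: path_formula_def f_sum_0)

lemma path_formula_snoc:
  "path_formula (x @ [One]) (y @ [One]) = f0_sum (x @ [One]) (y @ [One]) + path_formula x y"
  "path_formula (x @ [Two]) (y @ [Two]) =
    f0_sum (x @ [One, One]) (y @ [One, One]) + f0_sum (x @ [One]) (y @ [One]) + path_formula x y"
  "a \<noteq> b \<Longrightarrow> path_formula (x @ [a]) (y @ [b]) = f0_sum (x @ [a]) (y @ [b])"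
  by (simp_all add: path_formula_def f_sum_One f_sum_Two f_sum_0)

text \<open>Equal weights give
  \<open>2 * num_twos y \<le> weight y = weight x \<le> 2 * length x\<close>, with equality
  throughout only for words of twos. An appended 1 makes the bound of \<open>f0_sum_eq_0\<close>
  strict.\<close>

lemma path_formula_same_weight: "weight x = weight y \<Longrightarrow> path_formula x y = of_bool (x = y)"
proof (induction x arbitrary: y rule: rev_induct)
  case Nil
  then have "y = []" using length_le_weight[of y] by simp
  then show ?case by (simp add: path_formula_Nil f0_sum_Nil)
next
  case (snoc a x)
  then obtain y' b where y: "y = y' @ [b]"
    by (cases y rule: rev_cases) auto
  note le = num_twos_le_length[of x] num_twos_le_length[of y']
    weight_eq_length_num_twos[of x] weight_eq_length_num_twos[of y']
  show ?case
  proof (cases "a = b")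
    case True
    then have w: "weight x = weight y'"
      using snoc.prems y by simp
    then have "f0_sum (x @ [One]) (y' @ [One]) = 0" "f0_sum (x @ [One, One]) (y' @ [One, One]) = 0"
      using le by (auto intro!: f0_sum_eq_0)
    then show ?thesis
      using snoc.IH[OF w] y True by (cases a) (simp_all add: path_formula_snoc)
  next
    case False
    \<comment> \<open>One of the two last digits is 1, so the words do not both consist of
      twos.\<close>
    then have "f0_sum (x @ [a]) (y' @ [b]) = 0"
      using snoc.prems le unfolding y by (cases a; cases b; intro f0_sum_eq_0) simp_all
    then show ?thesis
      using False y by (simp add: path_formula_snoc)
  qed
qed

text \<open>The weight bound survives removal of a common last digit and keeps \<open>y\<close>
  nonempty while \<open>x\<close> is, so the added 1 is never compared with a digit of
  \<open>x\<close>.\<close>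

lemma path_formula_One: "weight x \<le> weight y \<Longrightarrow> path_formula x (One # y) = path_formula x y"
proof (induction x arbitrary: y rule: rev_induct)
  case Nil
  then show ?case by (simp add: path_formula_Nil)
next
  case (snoc a x)
  then obtain y' b where y: "y = y' @ [b]"
    by (cases y rule: rev_cases) auto
  show ?case
  proof (cases "a = b")
    case True
    then have "path_formula x (One # y') = path_formula x y'"
      using snoc y by simp
    then show ?thesis
      using path_formula_snoc(1,2)[of x "One # y'"] y True by (cases a) (simp_all add: path_formula_snoc)
  next
    case False
    then show ?thesis
      using path_formula_snoc(3)[of a b x "One # y'"] y by (simp add: path_formula_snoc)
  qed
qed

lemma path_formula_Nil_Two: "path_formula [] (Two # y) = (real (weight y) + 1) * path_formula [] y"
  by (simp add: path_formula_Nil f0_sum_Nil_Two)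

lemma f0_sum_singleton: "f0_sum [One] y = gprod y 0 - gprod y 1"
proof -
  have "{1, 0} - {1 :: real} = {0}" "{1, 0} - {0 :: real} = {1}" by auto
  then show ?thesis by (simp add: f0_sum_def divdiff_def)
qed

text \<open>All divided differences in \<open>path_formula_snoc\<close> obey
  \<open>f0_sum_Two\<close> with one and the same factor, because common last digits do not change
  the difference of the weights. A one-digit word is treated apart, since there \<open>tl\<close>
  removes the last digit too.\<close>

lemma path_formula_Two:
  assumes "x \<noteq> []" "weight x \<le> Suc (weight y)"
  shows "path_formula x (Two # y) = (real (weight y) + 1 - real (weight x)) * path_formula x y + path_formula (tl x) y"
  using assms
proof (induction x arbitrary: y rule: rev_induct)
  case (snoc a x)
  show ?case
  proof (cases y rule: rev_cases)
    case Nil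
    then have "x = []" "a = One"
      using snoc.prems length_le_weight[of x] by (cases a; simp)+
    then show ?thesis
      using Nil path_formula_snoc(3)[of One Two "[]" "[]"] by (simp add: path_formula_Nil f0_sum_Two)
  next
    case y: (snoc y' b)
    have tl: "tl (x @ u) = tl x @ u" if "x \<noteq> []" for u
      using that by (cases x) auto
    show ?thesis
    proof (cases "a = b")
      case False
      then have "path_formula (x @ [a]) (Two # y) = f0_sum (x @ [a]) (Two # y)" "path_formula (x @ [a]) y = f0_sum (x @ [a]) y"
        using path_formula_snoc(3)[of a b x "Two # y'"] path_formula_snoc(3)[of a b x y'] y by simp_all
      moreover have "path_formula (tl (x @ [a])) y = f0_sum (tl (x @ [a])) y"
        using False y tl[of "[a]"] by (cases "x = []") (simp_all add: path_formula_Nil path_formula_snoc)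
      ultimately show ?thesis
        by (simp add: f0_sum_Two)
    next
      case ab: True
      let ?c = "real (weight y') + 1 - real (weight x)"
      have w: "weight x \<le> Suc (weight y')"
        using snoc.prems ab y by simp
      have dd1: "f0_sum (x @ [One]) (Two # y' @ [One]) =
          ?c * f0_sum (x @ [One]) (y' @ [One]) + f0_sum (tl (x @ [One])) (y' @ [One])"
        by (subst f0_sum_Two) auto
      have dd2: "f0_sum (x @ [One, One]) (Two # y' @ [One, One]) =
          ?c * f0_sum (x @ [One, One]) (y' @ [One, One]) + f0_sum (tl (x @ [One, One])) (y' @ [One, One])"
        by (subst f0_sum_Two) auto
      have g2: "gprod (y' @ [One, One]) t = gprod y' (t - 2)" for t
        using gprod_snoc(1)[of "y' @ [One]"] by (simp add: algebra_simps)
      show ?thesis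
      proof (cases "x = []")
        case True
        show ?thesis
        proof (cases a)
          case One
          then show ?thesis
            using True y ab dd1 path_formula_snoc(1)[of "[]" "Two # y'"] path_formula_snoc(1)[of "[]" y'] path_formula_Nil_Two[of y']
            by (simp add: path_formula_Nil algebra_simps)
        next
          \<comment> \<open>The tail terms are \<open>gprod y' (-1)\<close> and
            \<open>gprod y' (-2) - gprod y' (-1)\<close>; their sum is
            \<open>path_formula [] (y' @ [Two])\<close>.\<close>
          case Two
          then show ?thesis
            using True y ab dd1 dd2 path_formula_snoc(2)[of "[]" "Two # y'"] path_formula_snoc(2)[of "[]" y'] path_formula_Nil_Two[of y']
            by (simp add: path_formula_Nil f0_sum_singleton f0_sum_Nil g2 algebra_simps)
        qed
      next
        case False
        then have IH: "path_formula x (Two # y') = ?c * path_formula x y' + path_formula (tl x) y'"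
          using snoc.IH w by simp
        show ?thesis
        proof (cases a)
          case One
          then show ?thesis
            using IH y ab dd1 path_formula_snoc(1)[of x "Two # y'"] path_formula_snoc(1)[of x y']
              path_formula_snoc(1)[of "tl x" y'] tl[OF False]
            by (simp add: algebra_simps)
        next
          case Two
          then show ?thesis
            using IH y ab dd1 dd2 path_formula_snoc(2)[of x "Two # y'"] path_formula_snoc(2)[of x y']
              path_formula_snoc(2)[of "tl x" y'] tl[OF False]
            by (simp add: algebra_simps)
        qed
      qed
    qed
  qed
qed simp

lemma num_paths_eq_path_formula: "weight x \<le> weight y \<Longrightarrow> real (num_paths x y) = path_formula x y"
proof (induction y arbitrary: x)
  case Nil
  then show ?case by (simp add: num_paths_same_weight path_formula_same_weight)
next
  case (Cons c y)
  show ?case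
  proof (cases "weight x = weight (c # y)")
    case True
    then show ?thesis by (simp add: num_paths_same_weight path_formula_same_weight)
  next
    case False
    show ?thesis
    proof (cases c)
      case One
      then show ?thesis using False Cons by (simp add: num_paths_One path_formula_One)
    next
      case Two
      then have w: "weight x \<le> Suc (weight y)"
        using False Cons.prems by simp
      show ?thesis
      proof (cases x)
        case Nil
        then show ?thesis using Two Cons.IH[of "[]"] by (simp add: num_paths_Nil_Two path_formula_Nil_Two algebra_simps)
      next
        case (Cons b v)
        then have ne: "x \<noteq> []"
          by simp
        have "real (num_paths (tl x) y) = path_formula (tl x) y"
          using Cons.IH[of v] w Cons by (cases b) simp_all
        \<comment> \<open>At \<open>weight x = Suc (weight y)\<close>, beyond the reach of the
          induction hypothesis, the factor is 0.\<close>
        moreover have "(real (weight y) + 1 - real (weight x)) * real (num_paths x y) =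
            (real (weight y) + 1 - real (weight x)) * path_formula x y"
          using Cons.IH[of x] w by (cases "weight x = Suc (weight y)") simp_all
        ultimately show ?thesis
          by (simp only: Two num_paths_Two[OF ne w] path_formula_Two[OF ne w])
      qed
    qed
  qed
qed

theorem mainTheorem1:
  fixes x y :: word and z :: nat
  assumes "weight x \<le> weight y"
    and "z = common_suffix_len x y"
  shows "real (num_paths x y) =
    (\<Sum>i = 0..weight x. f x i z * (\<Prod>j = 1..num_twos y. real (g y j) - real i))"
  using num_paths_eq_path_formula[OF assms(1)] by (simp only: path_formula_def f_sum_def prod_g assms(2))

end
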